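(* Let $k\ge 2$ and $m>0$ be integers, and let $(x,y,z)$ be an ordered non-minimal Markoff $m$-triple with $k$-Fibonacci components. Then $m=8$ and there exists an integer $n\ge 2$ such that $(x,y,z)=(F_2(2),F_2(2n),F_2(2n+2))$.
   Context: For a positive integer $k$, the $k$-Fibonacci numbers are defined by $F_k(0)=0$, $F_k(1)=1$ and $F_k(n)=kF_k(n-1)+F_k(n-2)$ for $n\ge 2$. For a positive integer $m$, a Markoff $m$-triple is a triple $(x,y,z)$ of positive integers satisfying $x^2+y^2+z^2=3xyz+m$. It is ordered if $x\le y\le z$. An ordered Markoff $m$-triple is minimal if $z\ge 3xy$, and non-minimal otherwise. A Markoff $m$-triple has $k$-Fibonacci components if $x,y,z$ are all $k$-Fibonacci numbers for that same $k$, i.e. $(x,y,z)=(F_k(a),F_k(b),F_k(c))$ for some positive integers $a,b,c$. *)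

theory Defs
  imports Main
begin

fun kfib :: "nat \<Rightarrow> nat \<Rightarrow> nat" where
  "kfib k 0 = 0"
| "kfib k (Suc 0) = 1"
| "kfib k (Suc (Suc n)) = k * kfib k (Suc n) + kfib k n"

definition markoff_triple :: "nat \<Rightarrow> nat \<times> nat \<times> nat \<Rightarrow> bool" where
  "markoff_triple m = (\<lambda>(x, y, z).
     x > 0 \<and> y > 0 \<and> z > 0 \<and> x\<^sup>2 + y\<^sup>2 + z\<^sup>2 = 3 * x * y * z + m)"

definition ordered_markoff_triple :: "nat \<Rightarrow> nat \<times> nat \<times> nat \<Rightarrow> bool" where
  "ordered_markoff_triple m = (\<lambda>(x, y, z). markoff_triple m (x, y, z) \<and> x \<le> y \<and> y \<le> z)"

definition minimal_markoff_triple :: "nat \<Rightarrow> nat \<times> nat \<times> nat \<Rightarrow> bool" where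
  "minimal_markoff_triple m = (\<lambda>(x, y, z).
     ordered_markoff_triple m (x, y, z) \<and> z \<ge> 3 * x * y)"

definition kfib_components :: "nat \<Rightarrow> nat \<times> nat \<times> nat \<Rightarrow> bool" where
  "kfib_components k = (\<lambda>(x, y, z).
     \<exists>a b c. a > 0 \<and> b > 0 \<and> c > 0 \<and> (x, y, z) = (kfib k a, kfib k b, kfib k c))"

end

theory Submission
  imports Defs
begin

text \<open>
  Write \<open>(x, y, z) = (F a, F b, F (b + d))\<close> and \<open>t = 3xy - z\<close>, so that \<open>m = x\<^sup>2 + y\<^sup>2 - tz\<close>.
  From \<open>F (b + d) = F b F (d + 1) + F (b - 1) F d\<close>, non-minimality gives \<open>F (d + 1) < 3 F a\<close>,
  hence \<open>d < a\<close>, or \<open>k = 2\<close> and \<open>d = a\<close>. In the former case \<open>y \<le> z \<le> 2xy\<close>, and concavity in \<open>z\<close>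
  yields \<open>tz \<ge> x\<^sup>2 + y\<^sup>2\<close>. In the latter case consecutive ratios of 2-Fibonacci numbers are bounded
  well enough to give the same inequality unless \<open>a = 2\<close>, where \<open>m\<close> is \<open>0\<close> or \<open>8\<close> by the
  Cassini identity, according to the parity of \<open>b\<close>.
\<close>

text \<open>The inductive step moves one unit from the first index to the second, hence the
  arbitrary \<open>d\<close>. Using \<open>Suc n\<close> avoids a predecessor.\<close>

lemma kfib_add:
  "kfib k (Suc n + d) = kfib k (Suc n) * kfib k (Suc d) + kfib k n * kfib k d"
proof (induction n arbitrary: d)
  case (Suc n)
  from Suc[of "Suc d"] show ?case by (simp add: algebra_simps)
qed simp

lemma kfib_Suc_ge: "k * kfib k n \<le> kfib k (Suc n)"
  by (cases n) simp_all

lemma strict_mono_kfib: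
  assumes "k \<ge> 2"
  shows "strict_mono (kfib k)"
proof -
  have "kfib k n < kfib k (Suc n)" for n
  proof (induction n)
    case (Suc n)
    have "2 * kfib k (Suc n) \<le> k * kfib k (Suc n)"
      using assms by (intro mult_right_mono) auto
    with Suc show ?case using kfib_Suc_ge[of k "Suc n"] by linarith
  qed simp
  then show ?thesis by (simp add: strict_mono_Suc_iff)
qed

lemma kfib_2_cassini:
  "(int (kfib 2 (Suc n)))\<^sup>2 - 2 * int (kfib 2 (Suc n)) * int (kfib 2 n) - (int (kfib 2 n))\<^sup>2
     = (-1) ^ n"
proof (induction n)
  case (Suc n)
  then show ?case by (simp add: power2_eq_square algebra_simps)
qed simp

text \<open>After expanding by the recurrence this is just
  \<open>2 * kfib 2 n \<le> kfib 2 (Suc n)\<close>. The constant 5/12 is the ratio of the third to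
  the fourth term, where equality holds.\<close>

lemma kfib_2_ratio: "12 * kfib 2 (Suc (Suc n)) \<le> 5 * kfib 2 (Suc (Suc (Suc n)))"
  using kfib_Suc_ge[of 2 n] by simp

lemma markoff_nonpos:
  fixes x y z :: int
  assumes "1 \<le> x" "x \<le> y" "y \<le> z" "z \<le> 2 * x * y"
  shows "x\<^sup>2 + y\<^sup>2 + z\<^sup>2 \<le> 3 * x * y * z"
proof -
  \<comment> \<open>Convexity in \<open>z\<close>: this product compares the quadratic on the
    interval from \<open>y\<close> to \<open>2xy\<close> with its values at the two
    endpoints.\<close>
  have "0 \<le> (z - y) * (2 * x * y - z)" using assms by simp
  moreover have "0 \<le> z * ((x - 1) * y)" using assms by simp
  moreover have "0 \<le> (x - 1) * (y * y)" using assms by simp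
  moreover have "x * x \<le> y * y" using assms by (intro mult_mono) auto
  ultimately show ?thesis by (simp add: power2_eq_square algebra_simps)
qed

text \<open>With \<open>z = 2y + w\<close> the claim becomes \<open>1 + yw + w^2 \<le> y^2\<close>.
  For positive \<open>n\<close>, \<open>2w \<le> y\<close> and \<open>2 \<le> y\<close> bound the
  left terms by 1/4, 1/2 and 1/4 of \<open>y^2\<close>.\<close>

lemma kfib_2_nonpos_1:
  "(kfib 2 (Suc 0))\<^sup>2 + (kfib 2 (Suc n))\<^sup>2 + (kfib 2 (Suc (Suc n)))\<^sup>2
     \<le> 3 * kfib 2 (Suc 0) * kfib 2 (Suc n) * kfib 2 (Suc (Suc n))"
proof (cases n)
  case (Suc l)
  define y w where "y = int (kfib 2 (Suc n))" and "w = int (kfib 2 n)"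
  have wy: "2 * w \<le> y" "0 \<le> w" unfolding y_def w_def using kfib_Suc_ge[of 2 n] by auto
  have "1 \<le> w"
    using strict_monoD[OF strict_mono_kfib[of 2], of 0 n] Suc by (simp add: w_def)
  then have "2 * 2 \<le> y * y" using wy by (intro mult_mono) auto
  moreover have "(2 * w) * y \<le> y * y" using wy by (intro mult_right_mono) auto
  moreover have "(2 * w) * (2 * w) \<le> y * y" using wy by (intro mult_mono) auto
  ultimately have "1\<^sup>2 + y\<^sup>2 + (2 * y + w)\<^sup>2 \<le> 3 * 1 * y * (2 * y + w)"
    by (simp add: power2_eq_square algebra_simps)
  then have "int ((kfib 2 (Suc 0))\<^sup>2 + (kfib 2 (Suc n))\<^sup>2 + (kfib 2 (Suc (Suc n)))\<^sup>2)
     \<le> int (3 * kfib 2 (Suc 0) * kfib 2 (Suc n) * kfib 2 (Suc (Suc n)))"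
    by (simp add: y_def w_def)
  then show ?thesis by (simp only: of_nat_le_iff)
qed simp

lemma kfib_2_nonpos_ge3:
  fixes x y z :: int
  assumes "a \<ge> 2" "b \<ge> 2" "a \<le> b"
    and x: "x = int (kfib 2 (Suc a))" and y: "y = int (kfib 2 (Suc b))"
    and z: "z = int (kfib 2 (Suc b + Suc a))"
  shows "x\<^sup>2 + y\<^sup>2 + z\<^sup>2 \<le> 3 * x * y * z"
proof -
  define u w where "u = int (kfib 2 a)" and "w = int (kfib 2 b)"
  have ratio: "12 * kfib 2 n \<le> 5 * kfib 2 (Suc n)" if "n \<ge> 2" for n
    using kfib_2_ratio[of "n - 2"] that by (simp add: numeral_2_eq_2 Suc_diff_Suc)
  have u: "12 * u \<le> 5 * x" "0 \<le> u" and w: "12 * w \<le> 5 * y" "0 \<le> w"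
    using ratio[of a] ratio[of b] assms by (simp_all add: u_def w_def)
  have "kfib 2 3 \<le> kfib 2 (Suc a)"
    using assms(1) by (intro monoD[OF strict_mono_mono[OF strict_mono_kfib]]) auto
  then have x5: "5 \<le> x" by (simp add: x numeral_eq_Suc)
  have xy: "x \<le> y"
    using assms(3) monoD[OF strict_mono_mono[OF strict_mono_kfib[of 2]], of "Suc a" "Suc b"]
    by (simp add: x y)
  have z_eq: "z = 2 * (x * y) + u * y + x * w"
  proof -
    have "kfib 2 (Suc b + Suc a) = kfib 2 (Suc b) * (2 * kfib 2 (Suc a) + kfib 2 a)
        + kfib 2 b * kfib 2 (Suc a)"
      using kfib_add[of 2 b "Suc a"] by simp
    then show ?thesis unfolding x y z u_def w_def by (simp add: algebra_simps)
  qed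
  define t where "t = 3 * (x * y) - z"
  have "12 * u * y \<le> 5 * x * y" "12 * w * x \<le> 5 * y * x"
    using u w x5 xy by (auto intro!: mult_right_mono)
  \<comment> \<open>Here \<open>t = xy - uy - xw\<close>, and each subtracted term is at most 5/12
    of \<open>xy\<close>.\<close>
  then have t: "x * y \<le> 6 * t" unfolding t_def z_eq by (simp add: algebra_simps)
  have z2: "2 * (x * y) \<le> z" using u w x5 xy unfolding z_eq by simp
  have xy0: "0 \<le> x * y" using x5 xy by simp
  have "(x * y) * (2 * (x * y)) \<le> (6 * t) * z"
    by (rule mult_mono[OF t z2]) (use t xy0 in auto)
  moreover have "(5 * y) * (5 * y) \<le> (x * y) * (x * y)"
    using x5 xy by (intro mult_mono) auto
  moreover have "x * x \<le> y * y" using x5 xy by (intro mult_mono) auto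
  moreover have "0 \<le> y * y" by simp
  ultimately have "x * x + y * y \<le> t * z" by linarith
  then show ?thesis unfolding t_def by (simp add: power2_eq_square algebra_simps)
qed

lemma kfib_2_markoff_2:
  "int ((kfib 2 2)\<^sup>2 + (kfib 2 (Suc n))\<^sup>2 + (kfib 2 (Suc n + 2))\<^sup>2)
     = int (3 * kfib 2 2 * kfib 2 (Suc n) * kfib 2 (Suc n + 2)) + 4 - 4 * (-1) ^ n"
  \<comment> \<open>Replacing the sign by its quadratic form leaves a polynomial identity in the
    terms at \<open>n\<close> and \<open>Suc n\<close>.\<close>
  unfolding kfib_2_cassini[of n, symmetric]
  by (simp add: numeral_2_eq_2 power2_eq_square algebra_simps)

theorem theorem1p1:
  fixes k m x y z :: nat
  assumes "k \<ge> 2" and "m > 0"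
    and "ordered_markoff_triple m (x, y, z)"
    and "\<not> minimal_markoff_triple m (x, y, z)"
    and "kfib_components k (x, y, z)"
  shows "m = 8 \<and> (\<exists>n\<ge>2. (x, y, z) = (kfib 2 2, kfib 2 (2 * n), kfib 2 (2 * n + 2)))"
proof -
  note sm = strict_mono_kfib[OF assms(1)]
  have eq: "x\<^sup>2 + y\<^sup>2 + z\<^sup>2 = 3 * x * y * z + m" and xy: "x \<le> y" and yz: "y \<le> z" and x0: "0 < x"
    using assms(3) by (auto simp: ordered_markoff_triple_def markoff_triple_def)
  have nonmin: "z < 3 * x * y"
    using assms(3,4) by (simp add: minimal_markoff_triple_def)
  have pos: "\<not> x\<^sup>2 + y\<^sup>2 + z\<^sup>2 \<le> 3 * x * y * z"
    using eq assms(2) by linarith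
  then have ipos: "\<not> (int x)\<^sup>2 + (int y)\<^sup>2 + (int z)\<^sup>2 \<le> 3 * int x * int y * int z"
    by (metis (mono_tags) of_nat_add of_nat_le_iff of_nat_mult of_nat_numeral of_nat_power)
  obtain a b c where abc: "a > 0" "b > 0" "c > 0" "x = kfib k a" "y = kfib k b" "z = kfib k c"
    using assms(5) by (auto simp: kfib_components_def)
  have ab: "a \<le> b" and bc: "b \<le> c"
    using xy yz abc strict_mono_less_eq[OF sm] by auto
  obtain a' where a': "a = Suc a'" using abc(1) by (cases a) auto
  obtain b' where b': "b = Suc b'" using abc(2) by (cases b) auto
  obtain d where c: "c = b + d" using bc le_Suc_ex by blast
  have z: "z = y * kfib k (Suc d) + kfib k b' * kfib k d"
    using kfib_add[of k b' d] by (simp add: abc b' c)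
  have "\<not> d < a"
  proof
    assume "d < a"
    then have "kfib k (Suc d) \<le> x" "kfib k d \<le> x" "kfib k b' \<le> y"
      using monoD[OF strict_mono_mono[OF sm]] by (auto simp: abc b')
    then have "z \<le> y * x + y * x" unfolding z by (intro add_mono mult_mono) auto
    then have "z \<le> 2 * x * y" by (simp add: algebra_simps)
    then have "int z \<le> 2 * int x * int y" by (metis of_nat_le_iff of_nat_mult of_nat_numeral)
    then show False using markoff_nonpos[of "int x" "int y" "int z"] ipos xy yz x0 by simp
  qed
  moreover have d3: "kfib k (Suc d) < 3 * x"
  proof -
    have "y * kfib k (Suc d) \<le> z" using z by simp
    also have "z < y * (3 * x)" using nonmin by (simp only: ac_simps)
    finally show ?thesis by (simp only: mult_less_cancel1)
  qed
  ultimately have k2: "k = 2" and da: "d = a"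
  proof -
    assume nd: "\<not> d < a"
    show "k = 2"
    proof (rule ccontr)
      assume "k \<noteq> 2"
      \<comment> \<open>For \<open>k \<ge> 3\<close> already the term at \<open>Suc a\<close>
        reaches \<open>3x\<close>, against \<open>d3\<close>.\<close>
      then have "3 * x \<le> k * x" using assms(1) by (intro mult_right_mono) auto
      also have "\<dots> \<le> kfib k (Suc a)" unfolding abc by (rule kfib_Suc_ge)
      also have "\<dots> \<le> kfib k (Suc d)" using nd by (intro monoD[OF strict_mono_mono[OF sm]]) auto
      finally show False using d3 by simp
    qed
    show "d = a"
    proof (rule ccontr)
      assume "d \<noteq> a"
      \<comment> \<open>If \<open>d > a\<close>, two applications of the growth bound give at least
        \<open>4x\<close>.\<close>
      have "3 * x \<le> 2 * (2 * x)" by simp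
      also have "\<dots> \<le> k * (k * x)" using assms(1) by (intro mult_mono) auto
      also have "\<dots> \<le> k * kfib k (Suc a)" unfolding abc by (intro mult_left_mono kfib_Suc_ge) auto
      also have "\<dots> \<le> kfib k (Suc (Suc a))" by (rule kfib_Suc_ge)
      also have "\<dots> \<le> kfib k (Suc d)"
        using nd \<open>d \<noteq> a\<close> by (intro monoD[OF strict_mono_mono[OF sm]]) auto
      finally show False using d3 by simp
    qed
  qed
  have a2: "a = 2"
  proof -
    have "a' \<noteq> 0"
    proof
      assume "a' = 0"
      then show False using pos kfib_2_nonpos_1[of b'] by (simp add: abc a' b' c da k2)
    qed
    moreover have "\<not> a' \<ge> 2"
      using kfib_2_nonpos_ge3[of a' b' "int x" "int y" "int z"] ipos ab
      by (auto simp: abc a' b' c da k2)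
    ultimately show ?thesis using a' by simp
  qed
  have m: "int m = 4 - 4 * (-1) ^ b'"
    using kfib_2_markoff_2[of b'] arg_cong[OF eq, of int] by (simp add: abc a2 b' c da k2)
  \<comment> \<open>An even \<open>b'\<close> would give \<open>m = 0\<close>.\<close>
  then have "odd b'" and "m = 8" using assms(2) by (cases "even b'"; simp)+
  then obtain n where n: "b = 2 * n" using b' by (metis evenE even_Suc)
  \<comment> \<open>For \<open>b = 2\<close> the triple is (2, 2, 12), which is minimal since 12 = 3
    * 2 * 2.\<close>
  have "b \<noteq> 2"
    using nonmin by (auto simp: abc a2 c da k2 numeral_eq_Suc)
  then have "n \<ge> 2" using n abc(2) by simp
  then show ?thesis using \<open>m = 8\<close> n by (auto simp: abc a2 c da k2)
qed

end
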